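(* Let $D$ be a converse invariant oriented graph. Then $P_D(x)=P_{-D}(x)$ as polynomials in $x$, where for a digraph $H$, \[P_H(x)=\sum_{u\in V(H)} (1+x)^{d^+_H(u)}(1-x)^{d^-_H(u)}.\]
   Context: All graphs and digraphs are finite, without loops or multiple edges/arcs. An oriented graph is a digraph with at most one arc between any pair of vertices. For a vertex $u$ of a digraph $H$, $d^+_H(u)$ and $d^-_H(u)$ denote its out-degree and in-degree. The converse $-D$ of a digraph $D$ is the digraph on the same vertex set with $(u,v)\in A(-D)$ if and only if $(v,u)\in A(D)$. A tournament is an orientation of a complete graph. For an oriented graph $D$ and a tournament $T$, $f_T(D)$ denotes the number of copies of $D$ in $T$, i.e. the number of (not necessarily induced) subdigraphs of $T$ isomorphic to $D$. An oriented graph $D$ is converse invariant if $f_T(D)=f_T(-D)$ for every tournament $T$. *)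

theory Defs
  imports
    "HOL-Computational_Algebra.Polynomial"
    "Graph_Theory.Digraph_Isomorphism"
    "Graph_Theory.Pair_Digraph"
begin

text \<open>
  Arcs of a \<^typ>\<open>'a pair_pre_digraph\<close> are ordered pairs of vertices, so multiple arcs are excluded
  by the representation; the locale \<^locale>\<open>pair_digraph\<close> adds finiteness and the absence of loops.
\<close>

locale oriented_graph = pair_digraph +
  assumes no_opposite_arcs: "(u, v) \<in> parcs G \<Longrightarrow> (v, u) \<notin> parcs G"

locale tournament = oriented_graph +
  assumes adjacent: "\<lbrakk>u \<in> pverts G; v \<in> pverts G; u \<noteq> v\<rbrakk> \<Longrightarrow> (u, v) \<in> parcs G \<or> (v, u) \<in> parcs G"

definition converse_digraph :: "'a pair_pre_digraph \<Rightarrow> 'a pair_pre_digraph" where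
  "converse_digraph D = \<lparr>pverts = pverts D, parcs = (parcs D)\<inverse>\<rparr>"

definition num_copies :: "'b pair_pre_digraph \<Rightarrow> 'a pair_pre_digraph \<Rightarrow> nat" where
  "num_copies T D =
    card {H :: 'b pair_pre_digraph.
      subgraph (with_proj H) (with_proj T) \<and> digraph_iso (with_proj D) (with_proj H)}"

text \<open>
  Every finite tournament is isomorphic to one whose vertices are natural numbers, so it is enough
  to quantify over those. The vertex type \<^typ>\<open>'a\<close> of \<open>D\<close> would not do: it may be finite.
\<close>

definition converse_invariant :: "'a pair_pre_digraph \<Rightarrow> bool" where
  "converse_invariant D \<longleftrightarrow>
    (\<forall>T :: nat pair_pre_digraph. tournament T \<longrightarrow>
      num_copies T D = num_copies T (converse_digraph D))"

definition degree_poly :: "'a pair_pre_digraph \<Rightarrow> int poly" where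
  "degree_poly H =
    (\<Sum>u\<in>pverts H.
      [:1, 1:] ^ out_degree (with_proj H) u * [:1, -1:] ^ in_degree (with_proj H) u)"

end

theory Submission
  imports Defs
begin

text \<open>
  Write \<open>P\<close> for the degree polynomial and \<open>n\<close> for the number of vertices of \<open>D\<close>. The idea is to
  average \<open>P\<close> over tournaments. If \<open>a\<close> and \<open>b\<close> are not adjacent in \<open>H\<close>, then orienting a new edge
  between them at random preserves the expected value of \<open>P\<close>, because it multiplies the summand of
  an end vertex by \<open>1 + x\<close> or \<open>1 - x\<close>, with mean 1 (\<open>degree_poly_add_arc_both_ways\<close>). Filling in the
  missing edges one after another shows that the average of \<open>P\<close> over all tournaments that contain \<open>H\<close>
  and have the same vertices is \<open>P H\<close> (\<open>sum_degree_poly_tournaments_containing\<close>).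

  Now sum \<open>f\<^sub>T(D) P(T)\<close> over all tournaments \<open>T\<close> on a fixed set of \<open>n\<close> vertices. Counting by copies
  of \<open>D\<close> instead of by tournaments, each copy \<open>H\<close> contributes the sum of \<open>P\<close> over the tournaments
  containing \<open>H\<close>, that is, \<open>P D\<close> times a power of 2 that depends only on the number of edges of \<open>D\<close>.
  So the weighted sum is a nonzero multiple of \<open>P D\<close> (\<open>sum_num_copies_degree_poly\<close>), and the factor is
  the same for \<open>D\<close> and its converse, since reversing all arcs matches the copies of one with those of
  the other. If \<open>D\<close> is converse invariant, then the weighted sums for \<open>D\<close> and its converse agree term
  by term, and cancelling the factor gives the equality of the polynomials.
\<close>

section \<open>Adding an arc to an oriented graph\<close>

definition add_arc :: "'a \<times> 'a \<Rightarrow> 'a pair_pre_digraph \<Rightarrow> 'a pair_pre_digraph" where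
  "add_arc e H = \<lparr>pverts = pverts H, parcs = insert e (parcs H)\<rparr>"

lemma add_arc_simps [simp]:
  "pverts (add_arc e H) = pverts H"
  "parcs (add_arc e H) = insert e (parcs H)"
  by (simp_all add: add_arc_def)

lemma out_degree_add_arc:
  assumes "finite (parcs H)" "e \<notin> parcs H"
  shows "out_degree (with_proj (add_arc e H)) u =
    (if u = fst e then Suc (out_degree (with_proj H) u) else out_degree (with_proj H) u)"
proof -
  have "out_arcs (with_proj (add_arc e H)) u =
      (if u = fst e then insert e (out_arcs (with_proj H) u) else out_arcs (with_proj H) u)"
    by (auto simp: out_arcs_def)
  moreover have "card (insert e (out_arcs (with_proj H) u)) = Suc (card (out_arcs (with_proj H) u))"
    using assms by (intro card_insert_disjoint) (auto simp: out_arcs_def)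
  ultimately show ?thesis
    unfolding out_degree_def by metis
qed

lemma in_degree_add_arc:
  assumes "finite (parcs H)" "e \<notin> parcs H"
  shows "in_degree (with_proj (add_arc e H)) u =
    (if u = snd e then Suc (in_degree (with_proj H) u) else in_degree (with_proj H) u)"
proof -
  have "in_arcs (with_proj (add_arc e H)) u =
      (if u = snd e then insert e (in_arcs (with_proj H) u) else in_arcs (with_proj H) u)"
    by (auto simp: in_arcs_def)
  moreover have "card (insert e (in_arcs (with_proj H) u)) = Suc (card (in_arcs (with_proj H) u))"
    using assms by (intro card_insert_disjoint) (auto simp: in_arcs_def)
  ultimately show ?thesis
    unfolding in_degree_def by metis
qed

text \<open>
  The two orientations of a new edge multiply the summand of an end vertex by \<open>1 + x\<close> and \<open>1 - x\<close>
  respectively, and these factors add up to 2; every other summand is counted twice unchanged.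
\<close>

lemma degree_poly_add_arc_both_ways:
  assumes "finite (parcs H)" "a \<noteq> b" "(a, b) \<notin> parcs H" "(b, a) \<notin> parcs H"
  shows "degree_poly (add_arc (a, b) H) + degree_poly (add_arc (b, a) H) = 2 * degree_poly H"
proof -
  have factors: "c * p * q + p * (d * q) = 2 * (p * q)" "p * (d * q) + c * p * q = 2 * (p * q)"
    if "c + d = 2" for c d p q :: "int poly"
    by (simp_all flip: that add: algebra_simps)
  have "[:1, 1:] + [:1, -1:] = (2 :: int poly)"
    by (simp add: numeral_poly)
  note factors = factors[OF this]
  show ?thesis
    unfolding degree_poly_def add_arc_simps sum_distrib_left sum.distrib[symmetric]
  proof (rule sum.cong[OF refl], goal_cases)
    case (1 u)
    show ?case
      using \<open>a \<noteq> b\<close> factors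
      by (simp add: out_degree_add_arc in_degree_add_arc assms(1,3,4) split del: if_split
          del: mult_pCons_left mult_pCons_right)
        (auto simp del: mult_pCons_left mult_pCons_right)
  qed
qed

lemma oriented_graph_iff:
  "oriented_graph H \<longleftrightarrow> finite (pverts H) \<and> parcs H \<subseteq> pverts H \<times> pverts H \<and>
    (\<forall>u v. (u, v) \<in> parcs H \<longrightarrow> u \<noteq> v \<and> (v, u) \<notin> parcs H)"
proof
  assume "oriented_graph H"
  then interpret oriented_graph H .
  show "finite (pverts H) \<and> parcs H \<subseteq> pverts H \<times> pverts H \<and>
    (\<forall>u v. (u, v) \<in> parcs H \<longrightarrow> u \<noteq> v \<and> (v, u) \<notin> parcs H)"
    using no_opposite_arcs pair_finite_verts by (fastforce dest: in_arcsD1 in_arcsD2 no_loops')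
next
  assume *: "finite (pverts H) \<and> parcs H \<subseteq> pverts H \<times> pverts H \<and>
    (\<forall>u v. (u, v) \<in> parcs H \<longrightarrow> u \<noteq> v \<and> (v, u) \<notin> parcs H)"
  then have "finite (parcs H)"
    by (meson finite_SigmaI finite_subset)
  with * show "oriented_graph H"
    by unfold_locales auto
qed

lemma tournament_iff:
  "tournament T \<longleftrightarrow> oriented_graph T \<and>
    (\<forall>u\<in>pverts T. \<forall>v\<in>pverts T. u \<noteq> v \<longrightarrow> (u, v) \<in> parcs T \<or> (v, u) \<in> parcs T)"
  by (auto simp: tournament_def tournament_axioms_def)

section \<open>Completing an oriented graph to a tournament\<close>

definition tournaments_containing :: "'a pair_pre_digraph \<Rightarrow> 'a pair_pre_digraph set" where
  "tournaments_containing H = {T. tournament T \<and> pverts T = pverts H \<and> parcs H \<subseteq> parcs T}"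

lemma finite_oriented_graphs_on:
  assumes "finite V"
  shows "finite {H. pverts H = V \<and> oriented_graph H}"
proof (rule finite_subset)
  show "{H. pverts H = V \<and> oriented_graph H} \<subseteq> pair_pre_digraph.make V ` Pow (V \<times> V)"
  proof
    fix H assume "H \<in> {H. pverts H = V \<and> oriented_graph H}"
    then have "H = pair_pre_digraph.make V (parcs H)" "parcs H \<in> Pow (V \<times> V)"
      by (auto simp: oriented_graph_iff pair_pre_digraph.make_def)
    then show "H \<in> pair_pre_digraph.make V ` Pow (V \<times> V)"
      by blast
  qed
qed (use assms in simp)

lemma finite_tournaments_containing:
  assumes "finite (pverts H)"
  shows "finite (tournaments_containing H)"
  by (rule finite_subset[OF _ finite_oriented_graphs_on[OF assms]])
    (auto simp: tournaments_containing_def tournament_iff)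

lemma card_off_diagonal:
  assumes "finite V"
  shows "card (V \<times> V - Id_on V) = card V * (card V - 1)"
proof -
  have "Id_on V = (\<lambda>v. (v, v)) ` V"
    by auto
  then have "finite (Id_on V)" "card (Id_on V) = card V"
    using assms by (auto simp: card_image inj_on_def)
  then show ?thesis
    by (subst card_Diff_subset) (auto simp: card_cartesian_product diff_mult_distrib2)
qed

lemma card_adjacent_pairs:
  assumes "oriented_graph H"
  shows "card (parcs H \<union> (parcs H)\<inverse>) = 2 * card (parcs H)"
proof -
  have "finite (parcs H)"
    using assms unfolding oriented_graph_iff by (meson finite_SigmaI finite_subset)
  moreover have "parcs H \<inter> (parcs H)\<inverse> = {}"
    using assms by (auto simp: oriented_graph_iff)
  ultimately show ?thesis
    by (simp add: card_Un_disjoint)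
qed

lemma adjacent_pairs_subset:
  assumes "oriented_graph H"
  shows "parcs H \<union> (parcs H)\<inverse> \<subseteq> pverts H \<times> pverts H - Id_on (pverts H)"
  using assms by (auto simp: oriented_graph_iff)

text \<open>
  This counts unordered pairs of distinct nonadjacent vertices. As it is written in terms of
  cardinalities only, its invariance under isomorphism and reversal is immediate; the truncating
  subtraction is harmless for oriented graphs by the lemma that follows.
\<close>

definition num_nonadjacent :: "'a pair_pre_digraph \<Rightarrow> nat" where
  "num_nonadjacent H = card (pverts H) * (card (pverts H) - 1) div 2 - card (parcs H)"

lemma twice_num_nonadjacent:
  assumes "oriented_graph H"
  shows "card (pverts H \<times> pverts H - Id_on (pverts H)) = 2 * card (parcs H) + 2 * num_nonadjacent H"
proof -
  have fin: "finite (pverts H)"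
    using assms by (simp add: oriented_graph_iff)
  have "2 * card (parcs H) \<le> card (pverts H) * (card (pverts H) - 1)"
    using card_mono[OF _ adjacent_pairs_subset[OF assms]] fin
    by (simp add: card_adjacent_pairs[OF assms] card_off_diagonal)
  moreover have "even (card (pverts H) * (card (pverts H) - 1))"
    by (cases "card (pverts H)") simp_all
  ultimately show ?thesis
    using fin by (simp only: card_off_diagonal num_nonadjacent_def) presburger
qed

text \<open>
  Induction on the number of nonadjacent pairs: the tournaments containing \<open>H\<close> split according to
  the direction in which they orient one such pair, and the two parts recombine by
  \<open>degree_poly_add_arc_both_ways\<close>. When no pair is left, \<open>H\<close> itself is the only tournament.
\<close>

lemma sum_degree_poly_tournaments_containing:
  assumes "oriented_graph H"
  shows "(\<Sum>T\<in>tournaments_containing H. degree_poly T) = 2 ^ num_nonadjacent H * degree_poly H"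
  using assms
proof (induction "num_nonadjacent H" arbitrary: H)
  case 0
  have fin: "finite (pverts H)"
    using 0 by (simp add: oriented_graph_iff)
  \<comment> \<open>Every pair is adjacent, as both sets have the same number of elements.\<close>
  have all: "parcs H \<union> (parcs H)\<inverse> = pverts H \<times> pverts H - Id_on (pverts H)"
    using fin 0 by (intro card_subset_eq adjacent_pairs_subset)
      (auto simp: card_adjacent_pairs twice_num_nonadjacent)
  have "parcs T = parcs H" if "T \<in> tournaments_containing H" for T
    using that all by (fastforce simp: tournaments_containing_def tournament_iff oriented_graph_iff)
  moreover have "tournament H"
    using 0 all by (auto simp: tournament_iff)
  ultimately have "tournaments_containing H = {H}"
    by (auto simp: tournaments_containing_def)
  then show ?case
    using 0 by simp
next
  case (Suc k)
  note H = \<open>oriented_graph H\<close>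
  have fin: "finite (pverts H)" "finite (parcs H)"
    using H unfolding oriented_graph_iff by (auto intro: finite_subset)
  have "parcs H \<union> (parcs H)\<inverse> \<noteq> pverts H \<times> pverts H - Id_on (pverts H)"
    using Suc card_adjacent_pairs[OF H] twice_num_nonadjacent[OF H] by auto
  then obtain a b where ab: "a \<in> pverts H" "b \<in> pverts H" "a \<noteq> b" "(a, b) \<notin> parcs H" "(b, a) \<notin> parcs H"
    using adjacent_pairs_subset[OF H] by auto
  have step: "oriented_graph (add_arc e H)" "num_nonadjacent (add_arc e H) = k"
    if "e = (a, b) \<or> e = (b, a)" for e
    using H ab fin that Suc(2) by (auto simp: oriented_graph_iff num_nonadjacent_def)
  have split: "tournaments_containing H =
      tournaments_containing (add_arc (a, b) H) \<union> tournaments_containing (add_arc (b, a) H)"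
    using ab by (auto simp: tournaments_containing_def tournament_iff)
  have disj: "tournaments_containing (add_arc (a, b) H) \<inter> tournaments_containing (add_arc (b, a) H) = {}"
    by (auto simp: tournaments_containing_def tournament_iff oriented_graph_iff)
  have "(\<Sum>T\<in>tournaments_containing H. degree_poly T) =
      2 ^ k * (degree_poly (add_arc (a, b) H) + degree_poly (add_arc (b, a) H))"
    unfolding split using disj fin
    by (subst sum.union_disjoint)
      (simp_all add: finite_tournaments_containing Suc(1) step distrib_left)
  also have "\<dots> = 2 ^ num_nonadjacent H * degree_poly H"
    using fin ab Suc(2) by (simp add: degree_poly_add_arc_both_ways flip: Suc(2))
  finally show ?case .
qed

section \<open>Isomorphic copies\<close>

text \<open>
  The general notion of isomorphism has separate maps for vertices and arcs. Since arcs are pairs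
  here, the arc map is forced by the vertex map.
\<close>

lemma digraph_iso_iff:
  assumes "oriented_graph D"
  shows "digraph_iso (with_proj D) (with_proj H) \<longleftrightarrow>
    (\<exists>f. inj_on f (pverts D) \<and> pverts H = f ` pverts D \<and> parcs H = map_prod f f ` parcs D)"
proof
  assume "digraph_iso (with_proj D) (with_proj H)"
  then obtain h where h: "pre_digraph.digraph_isomorphism (with_proj D) h"
    "with_proj H = app_iso h (with_proj D)"
    by (auto simp: digraph_iso_def)
  from h(2) have H: "pverts H = iso_verts h ` pverts D" "parcs H = iso_arcs h ` parcs D"
      "iso_tail h = fst" "iso_head h = snd"
    by (metis app_iso_simps with_proj_simps)+
  have "iso_arcs h e = map_prod (iso_verts h) (iso_verts h) e" if "e \<in> parcs D" for e
    using h(1) that H(3,4)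
    by (cases e) (auto simp: pre_digraph.digraph_isomorphism_def intro!: prod_eqI)
  then show "\<exists>f. inj_on f (pverts D) \<and> pverts H = f ` pverts D \<and> parcs H = map_prod f f ` parcs D"
    using h(1) H by (intro exI[of _ "iso_verts h"])
      (simp add: pre_digraph.digraph_isomorphism_def)
next
  assume "\<exists>f. inj_on f (pverts D) \<and> pverts H = f ` pverts D \<and> parcs H = map_prod f f ` parcs D"
  then obtain f where f: "inj_on f (pverts D)" "pverts H = f ` pverts D"
    "parcs H = map_prod f f ` parcs D"
    by blast
  interpret oriented_graph D by fact
  have "inj_on (map_prod f f) (parcs D)"
    using f(1) by (intro inj_on_subset[OF map_prod_inj_on]) (auto dest: in_arcsD1 in_arcsD2)
  then have "digraph_isomorphism
      \<lparr>iso_verts = f, iso_arcs = map_prod f f, iso_head = snd, iso_tail = fst\<rparr>"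
    using f(1) wf_digraph_axioms by (auto simp: digraph_isomorphism_def)
  then show "digraph_iso (with_proj D) (with_proj H)"
    unfolding digraph_iso_def using f
    by (intro exI conjI) (auto simp: app_iso_def with_proj_def)
qed

definition copies_on :: "'b set \<Rightarrow> 'a pair_pre_digraph \<Rightarrow> 'b pair_pre_digraph set" where
  "copies_on V D = {H. pverts H = V \<and> digraph_iso (with_proj D) (with_proj H)}"

lemma oriented_graph_iso:
  assumes "oriented_graph D" "digraph_iso (with_proj D) (with_proj H)"
  shows "oriented_graph H"
proof -
  obtain f where f: "inj_on f (pverts D)" "pverts H = f ` pverts D"
    "parcs H = map_prod f f ` parcs D"
    using assms by (auto simp: digraph_iso_iff)
  show ?thesis
    unfolding oriented_graph_iff
  proof (intro conjI allI impI)
    show "finite (pverts H)" "parcs H \<subseteq> pverts H \<times> pverts H"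
      using assms(1) f by (auto simp: oriented_graph_iff)
    fix u v assume "(u, v) \<in> parcs H"
    then obtain a b where ab: "u = f a" "v = f b" "(a, b) \<in> parcs D"
      using f by auto
    then have V: "a \<in> pverts D" "b \<in> pverts D" "a \<noteq> b" "(b, a) \<notin> parcs D"
      using assms(1) by (auto simp: oriented_graph_iff)
    then show "u \<noteq> v"
      using ab f(1) by (auto dest: inj_onD)
    show "(v, u) \<notin> parcs H"
    proof
      assume "(v, u) \<in> parcs H"
      then obtain c d where cd: "f b = f c" "f a = f d" "(c, d) \<in> parcs D"
        using ab f by auto
      then have "c \<in> pverts D" "d \<in> pverts D"
        using assms(1) by (auto simp: oriented_graph_iff)
      then have "c = b" "d = a"
        using cd V f(1) by (auto dest: inj_onD)
      then show False
        using cd V by simp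
    qed
  qed
qed

lemma degree_poly_iso:
  assumes "oriented_graph D" "digraph_iso (with_proj D) (with_proj H)"
  shows "degree_poly H = degree_poly D"
proof -
  interpret oriented_graph D by fact
  obtain h where h: "digraph_isomorphism h" "with_proj H = app_iso h (with_proj D)"
    using assms(2) by (auto simp: digraph_iso_def)
  have "pverts H = iso_verts h ` pverts D"
    by (metis h(2) verts_app_iso with_proj_simps(1))
  then show ?thesis
    using h by (simp add: degree_poly_def sum.reindex digraph_isomorphism_def
        in_degree_app_iso_eq[OF h(1)] out_degree_app_iso_eq[OF h(1)])
qed

lemma num_nonadjacent_iso:
  assumes "oriented_graph D" "digraph_iso (with_proj D) (with_proj H)"
  shows "num_nonadjacent H = num_nonadjacent D"
proof -
  obtain f where f: "inj_on f (pverts D)" "pverts H = f ` pverts D"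
    "parcs H = map_prod f f ` parcs D"
    using assms by (auto simp: digraph_iso_iff)
  have "inj_on (map_prod f f) (parcs D)"
    using f(1) assms(1)
    by (intro inj_on_subset[OF map_prod_inj_on]) (auto simp: oriented_graph_iff)
  then show ?thesis
    using f by (simp add: num_nonadjacent_def card_image)
qed

lemma finite_copies_on:
  assumes "oriented_graph D" "finite V"
  shows "finite (copies_on V D)"
  by (rule finite_subset[OF _ finite_oriented_graphs_on[OF assms(2)]])
    (auto simp: copies_on_def oriented_graph_iso[OF assms(1)])

lemma copies_on_nonempty:
  assumes "oriented_graph D" "finite V" "card V = card (pverts D)"
  shows "copies_on V D \<noteq> {}"
proof -
  obtain f where "bij_betw f (pverts D) V"
    using assms by (metis finite_same_card_bij oriented_graph_iff)
  then have "\<lparr>pverts = V, parcs = map_prod f f ` parcs D\<rparr> \<in> copies_on V D"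
    by (auto simp: copies_on_def digraph_iso_iff[OF assms(1)] bij_betw_def)
  then show ?thesis
    by blast
qed

text \<open>
  In a tournament with as many vertices as \<open>D\<close> every copy is spanning, so that the condition of being
  contained in \<open>T\<close> concerns only the arcs.
\<close>

lemma num_copies_spanning:
  assumes "oriented_graph D" "tournament T" "card (pverts T) = card (pverts D)"
  shows "num_copies T D = card {H \<in> copies_on (pverts T) D. T \<in> tournaments_containing H}"
proof -
  interpret T: tournament T by fact
  have "subgraph (with_proj H) (with_proj T) \<longleftrightarrow>
      pverts H = pverts T \<and> T \<in> tournaments_containing H"
    if "digraph_iso (with_proj D) (with_proj H)" for H
  proof -
    interpret H: oriented_graph H
      using assms(1) that by (rule oriented_graph_iso)
    have "card (pverts H) = card (pverts T)"
      using assms that by (auto simp: digraph_iso_iff card_image)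
    then have "pverts H \<subseteq> pverts T \<longleftrightarrow> pverts H = pverts T"
      using card_subset_eq T.pair_finite_verts by blast
    then show ?thesis
      using assms(2) T.wf_digraph_axioms H.wf_digraph_axioms
      by (auto simp: subgraph_def tournaments_containing_def compatible_def)
  qed
  then show ?thesis
    unfolding num_copies_def copies_on_def by (intro arg_cong[where f = card]) auto
qed

section \<open>Double counting\<close>

text \<open>
  Counting the pairs of a tournament and a copy of \<open>D\<close> inside it, first by tournaments and then by
  copies. Weighting with the degree polynomial of the tournament treats all vertices alike, so that
  neither automorphisms nor the position of a copy on \<open>V\<close> have to be taken into account.
\<close>

lemma sum_num_copies_degree_poly:
  assumes "oriented_graph D" "finite V" "card V = card (pverts D)"
  shows "(\<Sum>T | tournament T \<and> pverts T = V. of_nat (num_copies T D) * degree_poly T) =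
    of_nat (card (copies_on V D)) * 2 ^ num_nonadjacent D * degree_poly D"
proof -
  let ?T = "{T. tournament T \<and> pverts T = V}"
  have fin: "finite ?T"
    by (rule finite_subset[OF _ finite_oriented_graphs_on[OF assms(2)]]) (auto simp: tournament_iff)
  have "(\<Sum>T\<in>?T. of_nat (num_copies T D) * degree_poly T) =
      (\<Sum>T\<in>?T. \<Sum>H | H \<in> copies_on V D \<and> T \<in> tournaments_containing H. degree_poly T)"
    using assms by (intro sum.cong) (auto simp: num_copies_spanning)
  also have "\<dots> = (\<Sum>H\<in>copies_on V D. \<Sum>T | T \<in> ?T \<and> T \<in> tournaments_containing H. degree_poly T)"
    using fin assms by (intro sum.swap_restrict finite_copies_on)
  also have "\<dots> = (\<Sum>H\<in>copies_on V D. \<Sum>T\<in>tournaments_containing H. degree_poly T)"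
    by (intro sum.cong) (auto simp: copies_on_def tournaments_containing_def)
  also have "\<dots> = (\<Sum>H\<in>copies_on V D. 2 ^ num_nonadjacent D * degree_poly D)"
    using assms(1) by (intro sum.cong refl)
      (auto simp: copies_on_def sum_degree_poly_tournaments_containing oriented_graph_iso
        degree_poly_iso num_nonadjacent_iso)
  finally show ?thesis
    by (simp add: mult.assoc)
qed

section \<open>The converse digraph\<close>

lemma converse_digraph_simps [simp]:
  "pverts (converse_digraph D) = pverts D"
  "parcs (converse_digraph D) = (parcs D)\<inverse>"
  "converse_digraph (converse_digraph D) = D"
  by (simp_all add: converse_digraph_def)

lemma oriented_graph_converse:
  "oriented_graph D \<Longrightarrow> oriented_graph (converse_digraph D)"
  by (auto simp: oriented_graph_iff)

lemma digraph_iso_converse: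
  assumes "oriented_graph D" "digraph_iso (with_proj D) (with_proj H)"
  shows "digraph_iso (with_proj (converse_digraph D)) (with_proj (converse_digraph H))"
proof -
  have "(map_prod f f ` A)\<inverse> = map_prod f f ` A\<inverse>" for f :: "'a \<Rightarrow> 'b" and A
    by force
  then show ?thesis
    using assms by (auto simp: digraph_iso_iff oriented_graph_converse)
qed

lemma card_copies_on_converse:
  assumes "oriented_graph D"
  shows "card (copies_on V (converse_digraph D)) = card (copies_on V D)"
proof (rule bij_betw_same_card)
  show "bij_betw converse_digraph (copies_on V (converse_digraph D)) (copies_on V D)"
    using digraph_iso_converse[OF assms] digraph_iso_converse[OF oriented_graph_converse[OF assms]]
    by (intro bij_betw_byWitness[where f' = converse_digraph]) (auto simp: copies_on_def)
qed

theorem theorem1p3: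
  fixes D :: "'a pair_pre_digraph"
  assumes "oriented_graph D"
    and "converse_invariant D"
  shows "degree_poly D = degree_poly (converse_digraph D)"
proof -
  \<comment> \<open>Copies of \<open>D\<close> exist on this set, which makes the factor to be cancelled nonzero.\<close>
  let ?V = "{..<card (pverts D)}"
  let ?D' = "converse_digraph D"
  have D': "oriented_graph ?D'"
    using assms(1) by (rule oriented_graph_converse)
  have k: "num_nonadjacent ?D' = num_nonadjacent D"
    by (simp add: num_nonadjacent_def)
  let ?c = "of_nat (card (copies_on ?V D)) * 2 ^ num_nonadjacent D :: int poly"
  have "?c * degree_poly D =
      (\<Sum>T | tournament T \<and> pverts T = ?V. of_nat (num_copies T D) * degree_poly T)"
    using assms(1) by (simp add: sum_num_copies_degree_poly)
  also have "\<dots> = (\<Sum>T | tournament T \<and> pverts T = ?V. of_nat (num_copies T ?D') * degree_poly T)"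
    using assms(2) by (intro sum.cong) (auto simp: converse_invariant_def)
  also have "\<dots> = ?c * degree_poly ?D'"
    using D' assms(1) by (simp add: sum_num_copies_degree_poly card_copies_on_converse k)
  finally have "?c * degree_poly D = ?c * degree_poly ?D'" .
  moreover have "?c \<noteq> 0"
    using copies_on_nonempty[OF assms(1), of ?V] finite_copies_on[OF assms(1), of ?V] by simp
  ultimately show ?thesis
    using mult_left_cancel by blast
qed

end
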